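(* For all positive integers $n$ and non-negative integers $k$, with $n_1$ denoting a non-negative integer and $Q_m:=\dfrac{y^{(k+1)m}-x^{(k+1)m}}{y^{k+1}-x^{k+1}}$ (a polynomial in $x,y$), $$\det_{0\le i,j\le n-1}\Big(\sum_{l\ge0}\mathcal P^+_{i+j+1}(k,l)\Big)= \begin{cases} (-1)^{n_1\binom{k+1}2}(xy)^{(k+1)^2\binom{n_1+1}2-n}\big(Q_{n_1+1}+(-1)^kQ_{n_1}\big), & \text{if } n=(k+1)n_1,\\ (-1)^{n_1\binom{k+1}2}(xy)^{(k+1)^2\binom{n_1+1}2}(1+x)(1+y)\,Q_{n_1+1}, & \text{if } n=(k+1)n_1+1,\\ (-1)^{(n_1+1)\binom{k+1}2+k}(xy)^{(k+1)^2\binom{n_1+1}2+(k^2-1)(n_1+1)}(1+x)(1+y)\,Q_{n_1+1}, & \text{if } n=(k+1)n_1+k,\\ 0, & \text{if } n\not\equiv 0,1,k \pmod{k+1}. \end{cases}$$ For $k=0$ only the first case applies, and for $k=1$ only the first two cases apply.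
   Context: Three-step paths consist of up-steps $(1,1)$, level steps $(1,0)$ and down-steps $(1,-1)$. Weights: $w((1,1))=1$, $w((1,0))=x+y$, $w((1,-1))=xy$, and the weight $w(P)$ of a path is the product of the weights of its steps. $\mathcal P_n(k,l)=\sum_P w(P)$ over all three-step paths from $(0,k)$ to $(n,l)$; $\mathcal P^+_n(k,l)$ is the same sum restricted to paths that never run below the $x$-axis. For fixed $n,k$ the sum $\sum_{l\ge0}\mathcal P^+_n(k,l)$ is finite. These are polynomials in the indeterminates $x,y$. *)

theory Defs
  imports "HOL-Computational_Algebra.Polynomial" "HOL-Library.Groups_Big_Fun"
    "Jordan_Normal_Form.Determinant"
begin

text \<open>Bivariate polynomials in x, y with integer coefficients are modelled as
  int poly poly: the outer variable is y, the inner variable is x.\<close>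

definition varX :: "int poly poly" where "varX = [:[:0, 1:]:]"
definition varY :: "int poly poly" where "varY = [:0, 1:]"

text \<open>A three-step path is a list of steps: 1 = up (1,1), 0 = level (1,0),
  -1 = down (1,-1).\<close>

definition step_weight :: "int \<Rightarrow> int poly poly" where
  "step_weight s = (if s = 1 then 1 else if s = 0 then varX + varY else varX * varY)"

definition path_weight :: "int list \<Rightarrow> int poly poly" where
  "path_weight p = prod_list (map step_weight p)"

definition nonneg_paths :: "nat \<Rightarrow> nat \<Rightarrow> nat \<Rightarrow> int list set" where
  "nonneg_paths n k l = {p. length p = n \<and> set p \<subseteq> {-1, 0, 1}
      \<and> (\<forall>i\<le>n. int k + sum_list (take i p) \<ge> 0)
      \<and> int k + sum_list p = int l}"

definition Pplus :: "nat \<Rightarrow> nat \<Rightarrow> nat \<Rightarrow> int poly poly" where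
  "Pplus n k l = (\<Sum>p\<in>nonneg_paths n k l. path_weight p)"

definition Qpoly :: "nat \<Rightarrow> nat \<Rightarrow> int poly poly" where
  "Qpoly k m = (varY ^ ((k+1)*m) - varX ^ ((k+1)*m)) div (varY ^ (k+1) - varX ^ (k+1))"

end

theory Submission
  imports Defs
begin

text \<open>
  Let \<open>u = x y\<close> and let \<open>S\<^sub>m\<close> be the Chebyshev-like polynomials in \<open>z\<close> with \<open>S\<^sub>0 = 0\<close>, \<open>S\<^sub>1 = 1\<close>,
  \<open>S\<^sub>m\<^sub>+\<^sub>2 = (z - x - y) S\<^sub>m\<^sub>+\<^sub>1 - u S\<^sub>m\<close>. Since \<open>z\<^sup>n S\<^sub>k\<^sub>+\<^sub>1\<close> expands in the \<open>S\<^sub>l\<^sub>+\<^sub>1\<close> with coefficients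
  \<open>\<P>\<^sup>+\<^sub>n(k, l)\<close>, the determinant is \<open>det M(z\<^sup>i\<^sup>+\<^sup>j g)\<close> with \<open>g = z S\<^sub>K\<close>, \<open>K = k + 1\<close>, where \<open>M\<close> is the linear
  functional with \<open>M(S\<^sub>l\<^sub>+\<^sub>1) = 1\<close> for all \<open>l\<close>. The polynomials \<open>q\<^sub>j = S\<^sub>j\<^sub>+\<^sub>1 - S\<^sub>j\<close> are orthogonal for \<open>M\<close>
  with \<open>M(q\<^sub>j\<^sup>2) = u\<^sup>j\<close>, so Christoffel's formula reduces the \<open>n \<times> n\<close> determinant to the \<open>K \<times> K\<close>
  determinant of the remainders of \<open>q\<^sub>n, \<dots>, q\<^sub>n\<^sub>+\<^sub>k\<close> modulo \<open>g\<close>. Modulo \<open>S\<^sub>K\<close> the sequence \<open>S\<close> vanishes at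
  the multiples of \<open>K\<close> and is reflected there, \<open>S\<^sub>B\<^sub>+\<^sub>j = - u\<^sup>j S\<^sub>B\<^sub>-\<^sub>j\<close>; the factor \<open>z\<close> of \<open>g\<close> only adds the
  value at \<open>z = 0\<close>, where \<open>(y - x) S\<^sub>m = (-x)\<^sup>m - (-y)\<^sup>m\<close>. So the small matrix is nearly a
  permutation matrix, and it is singular unless \<open>n\<close> is \<open>0\<close>, \<open>1\<close> or \<open>k\<close> modulo \<open>K\<close>.
\<close>

subsection \<open>Determinants and Christoffel's formula\<close>

text \<open>Entries are given by an index function, so that blocks and changes of basis become plain
  rewriting of functions.\<close>

definition fdet :: "nat \<Rightarrow> (nat \<Rightarrow> nat \<Rightarrow> 'a::comm_ring_1) \<Rightarrow> 'a" where
  "fdet n A = det (mat n n (\<lambda>(i, j). A i j))"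

lemma fdet_cong:
  assumes "\<And>i j. i < n \<Longrightarrow> j < n \<Longrightarrow> A i j = B i j"
  shows "fdet n A = fdet n B"
  unfolding fdet_def by (rule arg_cong[of _ _ det]) (auto intro!: eq_matI simp: assms)

lemma fdet_mult: "fdet n (\<lambda>i j. \<Sum>l<n. A i l * B l j) = fdet n A * fdet n B"
proof -
  have "mat n n (\<lambda>(i, j). \<Sum>l<n. A i l * B l j)
      = mat n n (\<lambda>(i, j). A i j) * mat n n (\<lambda>(i, j). B i j)"
    by (intro eq_matI) (auto simp: scalar_prod_def atLeast0LessThan)
  then show ?thesis
    unfolding fdet_def by (simp add: det_mult[of _ n])
qed

lemma fdet_transpose: "fdet n (\<lambda>i j. A j i) = fdet n A"
proof -
  have "mat n n (\<lambda>(i, j). A j i) = transpose_mat (mat n n (\<lambda>(i, j). A i j))"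
    by (intro eq_matI) auto
  then show ?thesis
    unfolding fdet_def by (simp add: det_transpose[of _ n])
qed

lemma fdet_upper_triangular:
  assumes "\<And>i j. j < i \<Longrightarrow> i < n \<Longrightarrow> A i j = 0"
  shows "fdet n A = (\<Prod>i<n. A i i)"
proof -
  have "fdet n A = prod_list (diag_mat (mat n n (\<lambda>(i, j). A i j)))"
    unfolding fdet_def
    by (rule det_upper_triangular[of _ n]) (auto simp: assms)
  then show ?thesis
    by (simp add: prod_list_diag_prod atLeast0LessThan)
qed

lemma fdet_lower_triangular:
  assumes "\<And>i j. i < j \<Longrightarrow> j < n \<Longrightarrow> A i j = 0"
  shows "fdet n A = (\<Prod>i<n. A i i)"
  using fdet_upper_triangular[of n "\<lambda>i j. A j i"] assms fdet_transpose[of n A] by simp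

lemma fdet_block_lower:
  fixes A :: "nat \<Rightarrow> nat \<Rightarrow> 'a::idom"
  assumes "\<And>i j. i < a \<Longrightarrow> j < b \<Longrightarrow> A i (a + j) = 0"
  shows "fdet (a + b) A = fdet a A * fdet b (\<lambda>i j. A (a + i) (a + j))"
proof -
  have "mat (a + b) (a + b) (\<lambda>(i, j). A i j) =
    four_block_mat (mat a a (\<lambda>(i, j). A i j)) (0\<^sub>m a b)
      (mat b a (\<lambda>(i, j). A (a + i) j)) (mat b b (\<lambda>(i, j). A (a + i) (a + j)))"
    using assms by (intro eq_matI) (auto dest!: le_Suc_ex simp: not_less)
  then show ?thesis
    unfolding fdet_def by (simp add: det_four_block_mat_upper_right_zero[of _ a _ b])
qed

lemma fdet_block_upper:
  fixes A :: "nat \<Rightarrow> nat \<Rightarrow> 'a::idom"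
  assumes "\<And>i j. i < b \<Longrightarrow> j < a \<Longrightarrow> A (a + i) j = 0"
  shows "fdet (a + b) A = fdet a A * fdet b (\<lambda>i j. A (a + i) (a + j))"
  using fdet_block_lower[of a b "\<lambda>i j. A j i"] assms
    fdet_transpose[of "a + b" A] fdet_transpose[of a A]
    fdet_transpose[of b "\<lambda>i j. A (a + i) (a + j)"]
  by simp

text \<open>Carrying \<open>d\<close> rows past the other \<open>n\<close> costs
  \<open>d * n\<close> adjacent transpositions.\<close>

lemma fdet_rotate_rows:
  "fdet (d + n) A = (-1) ^ (d * n) * fdet (d + n) (\<lambda>i. A (if i < n then i + d else i - n))"
  unfolding fdet_def
  by (subst det_swap_initial_rows[of _ "d + n" d n])
     (auto intro!: arg_cong[of _ _ "\<lambda>B. _ * det B"])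

lemma fdet_zero_column:
  assumes "j < n" and "\<And>i. i < n \<Longrightarrow> A i j = 0"
  shows "fdet n A = 0"
proof -
  have "fdet n A = (\<Sum>i<n. mat n n (\<lambda>(i, j). A i j) $$ (i, j) * cofactor (mat n n (\<lambda>(i, j). A i j)) i j)"
    unfolding fdet_def by (rule laplace_expansion_column) (use assms in auto)
  also have "\<dots> = 0"
    by (rule sum.neutral) (use assms in auto)
  finally show ?thesis .
qed

text \<open>Expansion along the first column meets only the bottom entry, with sign
  \<open>(-1) ^ n\<close>; the exponents \<open>0, ..., n - 1\<close> add up to
  \<open>n choose 2\<close>.\<close>

lemma fdet_antidiagonal:
  "fdet n (\<lambda>i j. if i + j + 1 = n then w i else 0) = (-1) ^ (n choose 2) * (\<Prod>i<n. w i)"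
proof (induction n)
  case 0
  then show ?case by (simp add: fdet_def numeral_2_eq_2)
next
  case (Suc n)
  let ?A = "mat (Suc n) (Suc n) (\<lambda>(i, j). if i + j + 1 = Suc n then w i else 0)"
  have "det ?A = (\<Sum>i<Suc n. ?A $$ (i, 0) * cofactor ?A i 0)"
    by (rule laplace_expansion_column) auto
  also have "\<dots> = (\<Sum>i\<in>{n}. ?A $$ (i, 0) * cofactor ?A i 0)"
    by (rule sum.mono_neutral_right) auto
  also have "\<dots> = w n * ((-1) ^ n * det (mat_delete ?A n 0))"
    by (simp add: cofactor_def)
  also have "mat_delete ?A n 0 = mat n n (\<lambda>(i, j). if i + j + 1 = n then w i else 0)"
    by (intro eq_matI) (auto simp: mat_delete_def)
  also have "det \<dots> = (-1) ^ (n choose 2) * (\<Prod>i<n. w i)"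
    using Suc.IH by (simp add: fdet_def)
  finally show ?case
    by (simp add: fdet_def numeral_2_eq_2 power_add algebra_simps)
qed

lemma fdet_coeff_combination:
  fixes f h :: "nat \<Rightarrow> 'a::comm_ring_1 poly"
  assumes "\<And>r. r < n \<Longrightarrow> f r = (\<Sum>l<n. smult (A r l) (h l))"
  shows "fdet n (\<lambda>r c. coeff (f r) c) = fdet n A * fdet n (\<lambda>r c. coeff (h r) c)"
proof -
  have "fdet n (\<lambda>r c. coeff (f r) c) = fdet n (\<lambda>r c. \<Sum>l<n. A r l * coeff (h l) c)"
    by (rule fdet_cong) (simp add: assms coeff_sum)
  then show ?thesis by (simp add: fdet_mult)
qed

lemma fdet_coeff_monic:
  fixes q :: "nat \<Rightarrow> 'a::comm_ring_1 poly"
  assumes "\<And>i. i < n \<Longrightarrow> degree (q i) = i" "\<And>i. i < n \<Longrightarrow> coeff (q i) i = 1"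
  shows "fdet n (\<lambda>r c. coeff (q r) c) = 1"
  using fdet_lower_triangular[of n "\<lambda>r c. coeff (q r) c"] assms
  by (simp add: coeff_eq_0)

lemma poly_eq_sum_monom:
  fixes f :: "'a::comm_semiring_1 poly"
  assumes "degree f < N"
  shows "f = (\<Sum>j<N. smult (coeff f j) (monom 1 j))"
proof (rule poly_eqI)
  fix i
  show "coeff f i = coeff (\<Sum>j<N. smult (coeff f j) (monom 1 j)) i"
    using assms by (cases "i < N") (auto simp: coeff_sum coeff_eq_0 if_distrib[of "(*) _"] cong: if_cong)
qed

section \<open>Linear forms on polynomials and Christoffel's formula\<close>

locale linear_form =
  fixes M :: "'a::comm_ring_1 poly \<Rightarrow> 'a"
  assumes add: "M (f + g) = M f + M g"
    and smult: "M (smult c f) = c * M f"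
begin

lemma zero: "M 0 = 0"
  using smult[of 0 0] by simp

lemma diff: "M (f - g) = M f - M g"
  using add[of "f - g" g] by simp

lemma sum: "M (\<Sum>i\<in>I. f i) = (\<Sum>i\<in>I. M (f i))"
  by (induction I rule: infinite_finite_induct) (simp_all add: zero add)

lemma expand:
  assumes "degree f < N"
  shows "M (f * h) = (\<Sum>j<N. coeff f j * M (monom 1 j * h))"
proof -
  have "M (f * h) = M ((\<Sum>j<N. smult (coeff f j) (monom 1 j)) * h)"
    using poly_eq_sum_monom[OF assms] by simp
  then show ?thesis
    by (simp add: sum_distrib_right sum smult)
qed

end

text \<open>
  Write \<open>d = degree g\<close>. The polynomials \<open>q n, \<dots>, q (n + d - 1), g * q 0, \<dots>, g * q (n - 1)\<close> have degree
  less than \<open>n + d\<close>. Pairing them by \<open>M\<close> with \<open>q 0, \<dots>, q (n + d - 1)\<close> gives a block matrix that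
  contains the Hankel matrix of \<open>g\<close>, while reducing them modulo \<open>g\<close> leaves only the remainders of
  the first \<open>d\<close>; comparing the two determinants yields Christoffel's formula without any reference
  to the roots of \<open>g\<close>.
\<close>

lemma christoffel_determinant:
  fixes M :: "'a::field poly \<Rightarrow> 'a"
  assumes "linear_form M"
    and degq: "\<And>i. degree (q i) = i" and monq: "\<And>i. coeff (q i) i = 1"
    and orth: "\<And>i j. M (q i * q j) = (if i = j then h i else 0)"
    and hnz: "\<And>i. h i \<noteq> 0"
    and degg: "degree g = d" and mong: "coeff g d = 1"
  shows "fdet n (\<lambda>i j. M (monom 1 (i + j) * g))
    = (-1) ^ (n * d) * (\<Prod>i<n. h i) * fdet d (\<lambda>r c. coeff (q (n + r) mod g) c)"
proof -
  interpret linear_form M by fact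
  define N where "N = d + n"
  define F where "F = (\<lambda>r. if r < d then q (n + r) else g * q (r - d))"
  have g0: "g \<noteq> 0" using mong by auto
  have degF: "degree (F r) < N" if "r < N" for r
  proof (cases "r < d")
    case True then show ?thesis by (simp add: F_def degq N_def)
  next
    case False
    then show ?thesis using that degree_mult_le[of g "q (r - d)"] by (simp add: F_def degq degg N_def)
  qed
  let ?G = "\<lambda>j i. M (monom 1 j * q i)"
  \<comment> \<open>The coefficient matrix of the monic \<open>q\<close> is unitriangular, so
    \<open>?G\<close> has the determinant of the diagonal Gram matrix of the
    \<open>q\<close>.\<close>
  have "fdet N (\<lambda>r i. \<Sum>j<N. coeff (q r) j * ?G j i)
      = fdet N (\<lambda>r j. coeff (q r) j) * fdet N ?G"
    by (rule fdet_mult)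
  moreover have "fdet N (\<lambda>r i. \<Sum>j<N. coeff (q r) j * ?G j i) = fdet N (\<lambda>r i. M (q r * q i))"
    by (rule fdet_cong) (simp add: expand degq)
  moreover have "fdet N (\<lambda>r i. M (q r * q i)) = (\<Prod>i<N. h i)"
    by (subst fdet_lower_triangular) (auto simp: orth)
  ultimately have detG: "fdet N ?G = (\<Prod>i<N. h i)"
    by (simp add: fdet_coeff_monic degq monq)

  have "fdet N (\<lambda>r i. \<Sum>j<N. coeff (F r) j * ?G j i)
      = fdet N (\<lambda>r j. coeff (F r) j) * fdet N ?G"
    by (rule fdet_mult)
  moreover have "fdet N (\<lambda>r i. \<Sum>j<N. coeff (F r) j * ?G j i) = fdet N (\<lambda>r i. M (F r * q i))"
    by (rule fdet_cong) (simp add: expand[OF degF])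
  ultimately have 1: "fdet N (\<lambda>r i. M (F r * q i)) = fdet N (\<lambda>r j. coeff (F r) j) * (\<Prod>i<N. h i)"
    by (simp add: detG)

  \<comment> \<open>With the rows \<open>g * q r\<close> on top, orthogonality of
    \<open>q (n + r)\<close> to \<open>q i\<close> for \<open>i < n\<close> clears the lower left
    block and makes the lower right one diagonal.\<close>
  let ?F' = "\<lambda>i. F (if i < n then i + d else i - n)"
  have "fdet N (\<lambda>r i. M (F r * q i)) = (-1) ^ (d * n) * fdet (n + d) (\<lambda>r i. M (?F' r * q i))"
    unfolding N_def by (subst fdet_rotate_rows) (simp add: add.commute)
  also have "fdet (n + d) (\<lambda>r i. M (?F' r * q i))
     = fdet n (\<lambda>r i. M (?F' r * q i)) * fdet d (\<lambda>r i. M (?F' (n + r) * q (n + i)))"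
    by (rule fdet_block_upper) (simp add: F_def orth)
  also have "fdet d (\<lambda>r i. M (?F' (n + r) * q (n + i))) = (\<Prod>i<d. h (n + i))"
    by (subst fdet_lower_triangular) (auto simp: F_def orth)
  also have "fdet n (\<lambda>r i. M (?F' r * q i)) = fdet n (\<lambda>i j. M (monom 1 (i + j) * g))"
  proof -
    \<comment> \<open>The block is \<open>C H C^T\<close>, with \<open>H\<close> the Hankel matrix
      of \<open>g\<close> and \<open>C\<close> unitriangular.\<close>
    let ?C = "\<lambda>i j. coeff (q i) j"
    have "fdet n (\<lambda>r i. M (?F' r * q i))
        = fdet n (\<lambda>r i. \<Sum>l<n. ?C r l * (\<Sum>m<n. M (monom 1 (l + m) * g) * ?C i m))"
    proof (rule fdet_cong)
      fix r i assume "r < n" "i < n"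
      then have "M (?F' r * q i) = M (q r * (q i * g))"
        by (simp add: F_def mult_ac)
      also have "\<dots> = (\<Sum>l<n. ?C r l * M (monom 1 l * (q i * g)))"
        using \<open>r < n\<close> by (intro expand) (simp add: degq)
      also have "\<dots> = (\<Sum>l<n. ?C r l * M (q i * (monom 1 l * g)))"
        by (simp add: mult_ac)
      also have "\<dots> = (\<Sum>l<n. ?C r l * (\<Sum>m<n. ?C i m * M (monom 1 m * (monom 1 l * g))))"
        using \<open>i < n\<close> by (subst expand[of "q i" n]) (simp_all add: degq)
      also have "\<dots> = (\<Sum>l<n. ?C r l * (\<Sum>m<n. M (monom 1 (l + m) * g) * ?C i m))"
        by (simp add: mult.assoc[symmetric] mult_monom add.commute mult.commute[of "coeff (q i) _"])
      finally show "M (?F' r * q i) = \<dots>" .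
    qed
    also have "\<dots> = fdet n (\<lambda>i j. M (monom 1 (i + j) * g))"
      by (subst fdet_mult, subst fdet_mult, subst fdet_transpose[of _ "\<lambda>i j. coeff (q i) j"])
         (simp add: fdet_coeff_monic degq monq)
    finally show ?thesis .
  qed
  finally have 2: "fdet N (\<lambda>r i. M (F r * q i))
    = (-1) ^ (d * n) * (fdet n (\<lambda>i j. M (monom 1 (i + j) * g)) * (\<Prod>i<d. h (n + i)))" .

  \<comment> \<open>\<open>U\<close> records division by \<open>g\<close>: identity and quotient
    coefficients in the upper rows, coefficients of \<open>q\<close> in the lower ones. It is block
    triangular with determinant 1.\<close>
  define F2 where "F2 = (\<lambda>r. if r < d then q (n + r) mod g else g * monom 1 (r - d))"
  define U where "U = (\<lambda>r l. if r < d then (if l < d then (if l = r then 1 else 0) else coeff (q (n + r) div g) (l - d))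
      else if l < d then 0 else coeff (q (r - d)) (l - d))"
  have split: "(\<Sum>l<N. k l) = (\<Sum>l<d. k l) + (\<Sum>l<n. k (d + l))" for k :: "nat \<Rightarrow> 'a poly"
    unfolding N_def by (induction n) (simp_all add: algebra_simps)
  have tail: "(\<Sum>l<n. smult (coeff f l) (g * monom 1 l)) = g * f" if "degree f < n" for f
    by (subst (2) poly_eq_sum_monom[OF that]) (simp add: sum_distrib_left)
  have "fdet N (\<lambda>r j. coeff (F r) j) = fdet N U * fdet N (\<lambda>r j. coeff (F2 r) j)"
  proof (rule fdet_coeff_combination)
    fix r assume "r < N"
    show "F r = (\<Sum>l<N. smult (U r l) (F2 l))"
    proof (cases "r < d")
      case True
      let ?Q = "q (n + r) div g"
      \<comment> \<open>For \<open>n = 0\<close> the quotient vanishes, but its degree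
        \<open>0\<close> is not below \<open>n\<close>; hence the disjunction.\<close>
      have "?Q = 0 \<or> degree ?Q < n"
      proof (rule disjCI)
        assume "\<not> degree ?Q < n"
        show "?Q = 0"
        proof (rule ccontr)
          assume "?Q \<noteq> 0"
          then have "degree (g * ?Q) = d + degree ?Q"
            using g0 by (simp add: degree_mult_eq degg)
          moreover have "g * ?Q = q (n + r) - q (n + r) mod g"
            by (simp add: minus_mod_eq_mult_div)
          moreover have "degree (q (n + r) mod g) < d"
            using degree_mod_less'[OF g0, of "q (n + r)"] degg True
            by (cases "q (n + r) mod g = 0") auto
          then have "degree (q (n + r) - q (n + r) mod g) < d + n"
            using True by (intro degree_diff_less) (simp_all add: degq)
          ultimately show False using \<open>\<not> degree ?Q < n\<close> by simp
        qed
      qed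
      then have "(\<Sum>l<n. smult (coeff ?Q l) (g * monom 1 l)) = g * ?Q"
        using tail by auto
      moreover have "(\<Sum>l<d. smult (U r l) (F2 l)) = q (n + r) mod g"
      proof -
        have "(\<Sum>l<d. smult (U r l) (F2 l)) = (\<Sum>l<d. if l = r then q (n + r) mod g else 0)"
          by (rule sum.cong) (auto simp: U_def F2_def True)
        then show ?thesis using True by simp
      qed
      ultimately show ?thesis
        using True by (simp add: split F_def U_def F2_def)
    next
      case False
      moreover have "degree (q (r - d)) < n"
        using False \<open>r < N\<close> by (simp add: N_def degq)
      ultimately show ?thesis
        by (simp add: split F_def U_def F2_def tail)
    qed
  qed
  also have "fdet N U = 1"
  proof -
    have "fdet N U = fdet d U * fdet n (\<lambda>i j. U (d + i) (d + j))"
      unfolding N_def by (rule fdet_block_upper) (simp add: U_def)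
    also have "fdet d U = 1"
      by (subst fdet_lower_triangular) (auto simp: U_def)
    also have "fdet n (\<lambda>i j. U (d + i) (d + j)) = 1"
      by (simp add: U_def fdet_coeff_monic degq monq)
    finally show ?thesis by simp
  qed
  also have "fdet N (\<lambda>r j. coeff (F2 r) j) = fdet d (\<lambda>r c. coeff (q (n + r) mod g) c)"
  proof -
    have "fdet N (\<lambda>r j. coeff (F2 r) j) =
       fdet d (\<lambda>r j. coeff (F2 r) j) * fdet n (\<lambda>i j. coeff (F2 (d + i)) (d + j))"
      unfolding N_def
    proof (rule fdet_block_lower)
      fix i j assume "i < d" "j < n"
      then have "degree (q (n + i) mod g) < d"
        using degree_mod_less'[OF g0, of "q (n + i)"] degg by (cases "q (n + i) mod g = 0") auto
      then show "coeff (F2 i) (d + j) = 0"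
        using \<open>i < d\<close> by (simp add: F2_def coeff_eq_0)
    qed
    also have "fdet n (\<lambda>i j. coeff (F2 (d + i)) (d + j)) = 1"
      by (subst fdet_lower_triangular) (auto simp: F2_def mult.commute[of g] coeff_monom_mult coeff_eq_0 degg mong)
    also have "fdet d (\<lambda>r j. coeff (F2 r) j) = fdet d (\<lambda>r c. coeff (q (n + r) mod g) c)"
      by (rule fdet_cong) (simp add: F2_def)
    finally show ?thesis by simp
  qed
  finally have 3: "fdet N (\<lambda>r j. coeff (F r) j) = fdet d (\<lambda>r c. coeff (q (n + r) mod g) c)"
    by simp
  \<comment> \<open>The last \<open>d\<close> norms occur on both sides and cancel, being
    nonzero.\<close>
  have "(\<Prod>i<N. h i) = (\<Prod>i<n. h i) * (\<Prod>i<d. h (n + i))"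
    unfolding N_def by (induction d) (simp_all add: algebra_simps)
  moreover have "(\<Prod>i<d. h (n + i)) \<noteq> 0"
    using hnz by simp
  ultimately have "(-1) ^ (d * n) * fdet n (\<lambda>i j. M (monom 1 (i + j) * g))
      = fdet d (\<lambda>r c. coeff (q (n + r) mod g) c) * (\<Prod>i<n. h i)"
    using 1 2 3 by simp
  then have "(-1) ^ (d * n) * ((-1) ^ (d * n) * fdet n (\<lambda>i j. M (monom 1 (i + j) * g)))
      = (-1) ^ (d * n) * (fdet d (\<lambda>r c. coeff (q (n + r) mod g) c) * (\<Prod>i<n. h i))"
    by simp
  then show ?thesis
    by (simp add: mult.assoc[symmetric] power_mult_distrib[symmetric]) (simp add: mult_ac)
qed

subsection \<open>The orthogonal polynomials\<close>

lemma choose_two_add: "(a + b) choose 2 = (a choose 2) + (b choose 2) + a * b"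
  by (induction b) (simp_all add: numeral_2_eq_2 algebra_simps)

lemma choose_two_double: "2 * (a choose 2) + a = a * a"
  by (induction a) (simp_all add: numeral_2_eq_2 algebra_simps)

text \<open>Collects exponents of \<open>u\<close>: \<open>K * b choose 2\<close> comes from the
  norms, \<open>b * (K choose 2)\<close> from the reflections. The additive form avoids truncated
  subtraction.\<close>

lemma choose_two_mult: "((K * b) choose 2) + b * (K choose 2) + K * b = K\<^sup>2 * ((b + 1) choose 2)"
proof (induction b)
  case 0
  then show ?case by (simp add: numeral_2_eq_2)
next
  case (Suc b)
  have "Suc b + 1 choose 2 = (b + 1 choose 2) + Suc b"
    by (simp add: numeral_2_eq_2)
  moreover have "K * Suc b choose 2 = (K * b choose 2) + (K choose 2) + K * b * K"
    using choose_two_add[of "K * b" K] by (simp add: add.commute)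
  ultimately show ?case
    using Suc.IH choose_two_double[of K] by (simp add: algebra_simps power2_eq_square)
qed

text \<open>To be instantiated in the fraction field of \<open>int poly poly\<close>. The first
  assumption makes the norms \<open>u ^ j\<close> nonzero, the second does the same for the values
  of \<open>S m\<close> at \<open>0\<close> with \<open>m > 0\<close>.\<close>

locale chebyshev_data =
  fixes x y :: "'a::field"
  assumes xy_nz: "x * y \<noteq> 0"
    and pow_neq: "m > 0 \<Longrightarrow> x ^ m \<noteq> y ^ m"
begin

abbreviation "u \<equiv> x * y"

abbreviation "Z \<equiv> [:-(x + y), 1:]"

text \<open>
  \<open>S (m + 1)\<close> is the polynomial of degree \<open>m\<close> usually indexed by \<open>m\<close>. With this shift \<open>S 0 = 0\<close> and
  \<open>S a dvd S b\<close> whenever \<open>a dvd b\<close>.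
\<close>

fun S :: "nat \<Rightarrow> 'a poly" where
  "S 0 = 0"
| "S (Suc 0) = 1"
| "S (Suc (Suc m)) = Z * S (Suc m) - smult u (S m)"

lemma S_monic: "degree (S (Suc m)) = m \<and> coeff (S (Suc m)) m = 1"
proof (induction m rule: less_induct)
  case (less m)
  show ?case
  proof (cases m)
    case 0
    then show ?thesis by simp
  next
    case (Suc l)
    have IH: "degree (S (Suc l)) = l" "coeff (S (Suc l)) l = 1"
      using less.IH[of l] Suc by auto
    have nz: "S (Suc l) \<noteq> 0" using IH(2) by auto
    have deg: "degree (Z * S (Suc l)) = Suc l"
      using nz by (subst degree_mult_eq) (simp_all add: IH)
    have "coeff (Z * S (Suc l)) (Suc l) = 1"
      by (simp add: IH coeff_eq_0)
    moreover have "degree (S l) < Suc l"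
      using less.IH[of "l - 1"] Suc by (cases l) auto
    moreover have "degree (smult u (S l)) < Suc l"
      using calculation by (simp del: S.simps)
    ultimately show ?thesis
      using deg Suc degree_add_eq_left[of "- smult u (S l)" "Z * S (Suc l)"]
      by (simp add: coeff_eq_0 del: smult_minus_left)
  qed
qed

lemma degree_S: "degree (S (Suc m)) = m" and coeff_S: "coeff (S (Suc m)) m = 1"
  using S_monic by auto

text \<open>\<open>mom k n\<close> is the sum of \<open>\<P>\<^sup>+\<^sub>n(k, l)\<close> over \<open>l\<close>, unfolded by the first step of the path.\<close>

fun mom :: "nat \<Rightarrow> nat \<Rightarrow> 'a" where
  "mom k 0 = 1"
| "mom 0 (Suc n) = mom 1 n + (x + y) * mom 0 n"
| "mom (Suc k) (Suc n) = mom (Suc (Suc k)) n + (x + y) * mom (Suc k) n + u * mom k n"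

text \<open>The moment functional: \<open>z ^ i\<close> goes to the total weight of the
  \<open>i\<close>-step paths from height 0.\<close>

definition M :: "'a poly \<Rightarrow> 'a" where
  "M f = (\<Sum>i\<le>degree f. coeff f i * mom 0 i)"

lemma M_eq: "degree f \<le> N \<Longrightarrow> M f = (\<Sum>i\<le>N. coeff f i * mom 0 i)"
  unfolding M_def by (rule sum.mono_neutral_left) (auto simp: coeff_eq_0)

sublocale linear_form M
proof
  fix f g :: "'a poly" and c :: 'a
  define N where "N = max (degree f) (degree g)"
  have "degree (f + g) \<le> N" "degree f \<le> N" "degree g \<le> N"
    by (auto simp: N_def degree_add_le)
  then show "M (f + g) = M f + M g"
    by (simp add: M_eq[of _ N] algebra_simps sum.distrib)
  show "M (smult c f) = c * M f"
    using degree_smult_le[of c f] by (simp add: M_eq[of _ "degree f"] sum_distrib_left mult_ac)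
qed

lemma Z_mult: "Z * f = monom 1 1 * f - smult (x + y) f"
  by (simp add: monom_altdef algebra_simps smult_add_left smult_diff_left)

text \<open>The recurrence of \<open>S\<close> mirrors the first-step recursion of
  \<open>mom\<close>, solved for the highest start. Height 1 is separate: height 0 allows no
  down-step, matching \<open>S 0 = 0\<close>. \<open>n\<close> stays arbitrary because the
  recurrence raises the power of \<open>z\<close>.\<close>

lemma M_monom_S: "M (monom 1 n * S (Suc k)) = mom k n"
proof (induction k arbitrary: n rule: less_induct)
  case (less k)
  consider "k = 0" | "k = 1" | l where "k = Suc (Suc l)"
    by (metis One_nat_def not0_implies_Suc)
  then show ?case
  proof cases
    case 1
    then show ?thesis
      by (simp add: M_def degree_monom_eq if_distrib[of "\<lambda>c. c * _"] cong: if_cong)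
  next
    case 2
    have "monom 1 n * S (Suc k) = monom 1 (Suc n) * S (Suc 0) - smult (x + y) (monom 1 n * S (Suc 0))"
      using 2 by (simp add: monom_Suc algebra_simps smult_add_left smult_diff_left)
    then have "M (monom 1 n * S (Suc k)) = mom 0 (Suc n) - (x + y) * mom 0 n"
      using less.IH[of 0] 2 by (simp only: diff smult)
    then show ?thesis using 2 by simp
  next
    case 3
    have "monom 1 n * S (Suc k) = monom 1 (Suc n) * S (Suc (Suc l))
       - smult (x + y) (monom 1 n * S (Suc (Suc l))) - smult u (monom 1 n * S (Suc l))"
      unfolding 3 S.simps(3)[of "Suc l"] Z_mult
      by (simp add: monom_altdef algebra_simps del: S.simps(3))
    then have "M (monom 1 n * S (Suc k)) = mom (Suc l) (Suc n) - (x + y) * mom (Suc l) n - u * mom l n"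
      using less.IH[of l] less.IH[of "Suc l"] 3 by (simp only: diff smult)
    then show ?thesis using 3 by simp
  qed
qed

lemma M_S: "M (S (Suc k)) = 1"
  using M_monom_S[of 0 k] by (simp add: monom_0)

definition q :: "nat \<Rightarrow> 'a poly" where
  "q j = S (Suc j) - S j"

lemma q_monic: "degree (q j) = j \<and> coeff (q j) j = 1"
proof (cases j)
  case (Suc i)
  have "degree (S j) < degree (S (Suc j))"
    unfolding Suc by (simp add: degree_S del: S.simps)
  then have "degree (q j) = degree (S (Suc j))"
    unfolding q_def diff_conv_add_uminus by (intro degree_add_eq_left) simp
  then show ?thesis
    unfolding q_def Suc by (simp add: degree_S coeff_S coeff_eq_0 del: S.simps)
qed (simp add: q_def)

lemma degree_q: "degree (q j) = j" and coeff_q: "coeff (q j) j = 1"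
  using q_monic by auto

lemma Z_q: "Z * q (Suc j) = q (Suc (Suc j)) + smult u (q j)"
  unfolding q_def S.simps(3)[of "Suc j"] S.simps(3)[of j]
  by (simp add: algebra_simps smult_diff_right)

lemma M_q: "M (q j) = (if j = 0 then 1 else 0)"
proof (cases j)
  case 0
  then show ?thesis using M_S[of 0] by (simp add: q_def)
next
  case (Suc i)
  then show ?thesis by (simp add: q_def diff M_S del: S.simps)
qed

text \<open>A factor \<open>Z\<close> is moved from \<open>S\<close> to \<open>q\<close>, where
  \<open>Z_q\<close> shifts the index by one in either direction.\<close>

lemma M_S_q: "M (S (Suc i) * q j) = (if i < j then 0 else u ^ j)"
proof (induction i arbitrary: j rule: less_induct)
  case (less i)
  consider "i = 0" | "j = 0" | l where "j \<noteq> 0" "i = Suc l"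
    by (metis not0_implies_Suc)
  then show ?case
  proof cases
    case 1
    then show ?thesis by (simp add: M_q)
  next
    case 2
    then show ?thesis using M_S[of i] by (simp add: q_def del: S.simps) simp
  next
    case 3
    obtain m where j: "j = Suc m" using 3 by (metis not0_implies_Suc)
    have "S (Suc i) * q j = S (Suc l) * (Z * q (Suc m)) - smult u (S l * q j)"
      unfolding 3 j by (simp add: algebra_simps)
    also have "\<dots> = S (Suc l) * q (Suc (Suc m)) + smult u (S (Suc l) * q m) - smult u (S l * q j)"
      unfolding Z_q by (simp add: algebra_simps)
    finally have "M (S (Suc i) * q j) = M (S (Suc l) * q (Suc (Suc m)))
        + u * M (S (Suc l) * q m) - u * M (S l * q j)"
      by (simp add: add diff smult)
    \<comment> \<open>The induction hypothesis is used at \<open>l - 1\<close>, hence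
      \<open>l \<le> j\<close>; for \<open>l = 0\<close> the product is zero.\<close>
    moreover have "M (S l * q j) = (if l \<le> j then 0 else u ^ j)"
      using less.IH[of "l - 1" j] 3 by (cases l) (auto simp: zero)
    ultimately show ?thesis
      using less.IH[of l] 3 j by (auto simp: not_less)
  qed
qed

text \<open>As a function of \<open>i\<close>, \<open>M (S (Suc i) * q j)\<close> jumps only at
  \<open>i = j\<close>; differencing isolates that point.\<close>

lemma M_q_q: "M (q i * q j) = (if i = j then u ^ i else 0)"
proof -
  have "M (q i * q j) = M (S (Suc i) * q j) - M (S i * q j)"
    by (simp add: q_def[of i] left_diff_distrib diff del: S.simps)
  then show ?thesis
    by (cases i) (auto simp: M_S_q zero simp del: S.simps(2,3))
qed

subsection \<open>Reduction modulo the Christoffel factor\<close>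

text \<open>The addition formula of Chebyshev polynomials of the second kind, with weight
  \<open>u\<close> and shifted index.\<close>

lemma S_add: "S (Suc (m + n)) = S (Suc m) * S (Suc n) - smult u (S m * S n)"
proof (induction n rule: induct_nat_012)
  case (ge2 n)
  have "S (Suc (m + Suc (Suc n))) = Z * S (Suc (m + Suc n)) - smult u (S (Suc (m + n)))"
    by simp
  also have "\<dots> = S (Suc m) * (Z * S (Suc (Suc n)) - smult u (S (Suc n)))
      - smult u (S m * (Z * S (Suc n) - smult u (S n)))"
    unfolding ge2.IH by (simp add: algebra_simps smult_diff_right del: S.simps mult_pCons_left mult_pCons_right)
  finally show ?case by (simp del: mult_pCons_left mult_pCons_right)
qed simp_all

lemma S_dvd_S_mult: "S (Suc k) dvd S (Suc k * b)"
proof (induction b)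
  case (Suc b)
  have "S (Suc k * Suc b) = S (Suc (Suc k * b + k))"
    by (simp add: algebra_simps)
  also have "\<dots> = S (Suc (Suc k * b)) * S (Suc k) - smult u (S (Suc k * b) * S k)"
    by (rule S_add)
  finally show ?case
    using Suc.IH by (simp only: dvd_diff dvd_smult dvd_mult2 dvd_triv_right)
qed simp

text \<open>As a function of \<open>j\<close> the sum obeys the recurrence of \<open>S\<close>,
  starting from \<open>2 * S m\<close> and \<open>Z * S m\<close>.\<close>

lemma S_dvd_reflect: "j \<le> m \<Longrightarrow> S m dvd S (m + j) + smult (u ^ j) (S (m - j))"
proof (induction j rule: induct_nat_012)
  case 0
  then show ?case by (simp add: dvd_add)
next
  case 1
  then obtain l where m: "m = Suc l" by (cases m) auto
  have "S (m + Suc 0) + smult (u ^ Suc 0) (S (m - Suc 0)) = Z * S m"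
    unfolding m by (simp del: mult_pCons_left mult_pCons_right)
  then show ?case by (simp only: dvd_triv_right)
next
  case (ge2 j)
  then obtain l where m: "m = Suc (Suc (l + j))" by (metis add.commute add_Suc_right le_Suc_ex)
  have S_eq: "S (m - j) = Z * S (m - Suc j) - smult u (S (m - Suc (Suc j)))"
    unfolding m by (simp add: Suc_diff_le del: mult_pCons_left mult_pCons_right)
  have "smult (u ^ Suc (Suc j)) (S (m - Suc (Suc j)))
      = Z * smult (u ^ Suc j) (S (m - Suc j)) - smult u (smult (u ^ j) (S (m - j)))"
    unfolding S_eq
    by (simp add: smult_diff_right mult_smult_right mult_ac del: S.simps mult_pCons_left mult_pCons_right)
  then have "S (m + Suc (Suc j)) + smult (u ^ Suc (Suc j)) (S (m - Suc (Suc j)))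
     = Z * (S (m + Suc j) + smult (u ^ Suc j) (S (m - Suc j)))
       - smult u (S (m + j) + smult (u ^ j) (S (m - j)))"
    by (simp add: distrib_left smult_add_right del: mult_pCons_left mult_pCons_right power_Suc)
  then show ?case
    using ge2 by (simp add: dvd_diff dvd_smult dvd_mult del: S.simps mult_pCons_left mult_pCons_right power_Suc)
qed

section \<open>Values at \<open>z = 0\<close>\<close>

abbreviation s :: "nat \<Rightarrow> 'a" where
  "s m \<equiv> poly (S m) 0"

lemma s_Suc_Suc: "s (Suc (Suc m)) = - (x + y) * s (Suc m) - u * s m"
  by simp

text \<open>At \<open>z = 0\<close> the recurrence has the characteristic roots \<open>-x\<close>
  and \<open>-y\<close>.\<close>

lemma s_closed: "(y - x) * s m = (- x) ^ m - (- y) ^ m"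
proof (induction m rule: induct_nat_012)
  case (ge2 m)
  have "(y - x) * s (Suc (Suc m)) = - (x + y) * ((y - x) * s (Suc m)) - u * ((y - x) * s m)"
    unfolding s_Suc_Suc by (simp add: algebra_simps del: S.simps)
  then show ?case
    unfolding ge2 by (simp add: algebra_simps)
qed simp_all

lemma s_nz:
  assumes "m > 0"
  shows "s m \<noteq> 0"
proof
  assume "s m = 0"
  then have "(- x) ^ m = (- y) ^ m"
    using s_closed[of m] by simp
  then have "x ^ m = y ^ m"
    by (simp add: power_minus[of x] power_minus[of y])
  then show False using pow_neq assms by blast
qed

section \<open>Congruences modulo \<open>G k\<close>\<close>

definition G :: "nat \<Rightarrow> 'a poly" where
  "G k = monom 1 1 * S (Suc k)"

lemma G_monic: "degree (G k) = Suc k" "coeff (G k) (Suc k) = 1"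
proof -
  have "S (Suc k) \<noteq> 0" using coeff_S[of k] by force
  then show "degree (G k) = Suc k" "coeff (G k) (Suc k) = 1"
    unfolding G_def
    by (simp_all add: degree_mult_eq degree_monom_eq degree_S coeff_S coeff_monom_mult del: S.simps)
qed

text \<open>\<open>S (Suc k)\<close> does not vanish at \<open>0\<close>, so it is coprime to the
  other factor \<open>z\<close> of \<open>G k\<close>.\<close>

lemma mod_G_eqI:
  assumes "S (Suc k) dvd f - h" and "poly f 0 = poly h 0"
  shows "f mod G k = h mod G k"
proof -
  obtain r where r: "f - h = S (Suc k) * r" using assms(1) by (auto elim: dvdE)
  have "poly (f - h) 0 = 0" using assms(2) by simp
  then have "poly r 0 = 0"
    using s_nz[of "Suc k"] unfolding r by (simp del: S.simps)
  then have "[:0, 1:] dvd r" by (simp add: poly_eq_0_iff_dvd)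
  then have "G k dvd f - h"
    unfolding r G_def by (auto simp: monom_altdef mult.commute[of "[:0, 1:]"] intro!: mult_dvd_mono simp del: S.simps mult_pCons_left mult_pCons_right)
  then show ?thesis by (simp add: mod_eq_dvd_iff)
qed

text \<open>Both sides vanish modulo \<open>S (Suc k)\<close>; the ratio matches their values at
  \<open>0\<close>.\<close>

lemma S_multiple_mod:
  assumes "t' > 0"
  shows "S (Suc k * t) mod G k = smult (s (Suc k * t) / s (Suc k * t')) (S (Suc k * t')) mod G k"
proof (rule mod_G_eqI)
  show "S (Suc k) dvd S (Suc k * t) - smult (s (Suc k * t) / s (Suc k * t')) (S (Suc k * t'))"
    by (intro dvd_diff dvd_smult S_dvd_S_mult)
  show "poly (S (Suc k * t)) 0 = poly (smult (s (Suc k * t) / s (Suc k * t')) (S (Suc k * t'))) 0"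
    using s_nz[of "Suc k * t'"] assms by simp
qed

text \<open>The reflection modulo \<open>S (Suc k)\<close>, corrected by a multiple of
  \<open>S (Suc k * t)\<close> that restores the value at \<open>0\<close>.\<close>

lemma S_reflect_mod:
  assumes "t > 0" and "j \<le> Suc k * t"
  shows "S (Suc k * t + j) mod G k =
    (smult ((s (Suc k * t + j) + u ^ j * s (Suc k * t - j)) / s (Suc k * t)) (S (Suc k * t))
      - smult (u ^ j) (S (Suc k * t - j))) mod G k"
proof (rule mod_G_eqI)
  let ?B = "Suc k * t"
  let ?c = "(s (?B + j) + u ^ j * s (?B - j)) / s ?B"
  have "S (Suc k) dvd S (?B + j) + smult (u ^ j) (S (?B - j)) - smult ?c (S ?B)"
    by (intro dvd_diff dvd_smult S_dvd_S_mult dvd_trans[OF S_dvd_S_mult S_dvd_reflect] assms)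
  then show "S (Suc k) dvd S (?B + j) - (smult ?c (S ?B) - smult (u ^ j) (S (?B - j)))"
    by (simp add: algebra_simps del: S.simps mult_Suc)
  have "s ?B \<noteq> 0"
    using assms by (intro s_nz) simp
  then show "s (?B + j) = poly (smult ?c (S ?B) - smult (u ^ j) (S (?B - j))) 0"
    by (simp del: S.simps mult_Suc)
qed

lemma S_reflect_mod_1:
  assumes "t > 0"
  shows "S (Suc k * t + 1) mod G k =
    (smult (- (x + y)) (S (Suc k * t)) - smult u (S (Suc k * t - 1))) mod G k"
proof -
  let ?B = "Suc k * t"
  have nz: "s ?B \<noteq> 0" using assms by (intro s_nz) simp
  obtain l where l: "?B = Suc l" using assms by (cases ?B) auto
  have "(s (?B + 1) + u ^ 1 * s (?B - 1)) / s ?B = - (x + y)"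
    using nz s_Suc_Suc[of l] unfolding l by (simp del: S.simps add: field_simps)
  then show ?thesis
    using S_reflect_mod[OF assms, of 1 k] assms l by (simp del: S.simps mult_Suc)
qed

text \<open>The small determinant of Christoffel's formula, an alternating multilinear form on the
  quotient by \<open>G k\<close>.\<close>

definition Delta :: "nat \<Rightarrow> (nat \<Rightarrow> 'a poly) \<Rightarrow> 'a" where
  "Delta k f = fdet (Suc k) (\<lambda>r c. coeff (f r mod G k) c)"

lemma Delta_combination:
  assumes "\<And>r. r \<le> k \<Longrightarrow> f r mod G k = (\<Sum>l<Suc k. smult (A r l) (h l)) mod G k"
  shows "Delta k f = fdet (Suc k) A * Delta k h"
  unfolding Delta_def
proof (rule fdet_coeff_combination)
  fix r assume "r < Suc k"
  have "(\<Sum>l<n. smult (A r l) (h l)) mod G k = (\<Sum>l<n. smult (A r l) (h l mod G k))" for n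
    by (induction n) (simp_all add: poly_mod_add_left mod_smult_left)
  then show "f r mod G k = (\<Sum>l<Suc k. smult (A r l) (h l mod G k))"
    using assms[of r] \<open>r < Suc k\<close> by (simp only: less_Suc_eq_le)
qed

lemma sum_smult_unit:
  fixes t n :: nat
  shows "t < n \<Longrightarrow> (\<Sum>l<n. smult (if l = t then c else 0) (h l)) = smult (c :: 'b::comm_ring_1) (h t)"
  by (simp add: if_distrib[of "\<lambda>c. smult c _"] cong: if_cong)

text \<open>The base change differs from the identity only in its last column.\<close>

lemma Delta_last_column:
  assumes "\<And>r. r < k \<Longrightarrow> f r mod G k = (h r + smult (a r) (h k)) mod G k"
    and "f k mod G k = smult \<gamma> (h k) mod G k"
  shows "Delta k f = \<gamma> * Delta k h"
proof -
  define A where "A = (\<lambda>r l. if r < k then (if l = r then 1 else 0) + (if l = k then a r else 0)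
     else (if l = k then \<gamma> else 0))"
  have "Delta k f = fdet (Suc k) A * Delta k h"
  proof (rule Delta_combination)
    fix r assume "r \<le> k"
    then show "f r mod G k = (\<Sum>l<Suc k. smult (A r l) (h l)) mod G k"
      using assms unfolding A_def
      by (cases "r < k") (simp_all add: smult_add_left sum.distrib sum_smult_unit del: sum.lessThan_Suc)
  qed
  also have "fdet (Suc k) A = (\<Prod>i<Suc k. A i i)"
    by (rule fdet_upper_triangular) (auto simp: A_def)
  also have "\<dots> = \<gamma>" by (simp add: A_def)
  finally show ?thesis .
qed

lemma Delta_last_row:
  assumes "\<And>r. r < k \<Longrightarrow> f r mod G k = h r mod G k"
    and "f k mod G k = (smult \<gamma> (h k) + (\<Sum>l<k. smult (a l) (h l))) mod G k"
  shows "Delta k f = \<gamma> * Delta k h"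
proof -
  define A where "A = (\<lambda>r l. if r < k then (if l = r then 1 else 0) else if l = k then \<gamma> else a l)"
  have "Delta k f = fdet (Suc k) A * Delta k h"
  proof (rule Delta_combination)
    fix r assume "r \<le> k"
    then show "f r mod G k = (\<Sum>l<Suc k. smult (A r l) (h l)) mod G k"
      using assms unfolding A_def
      by (cases "r < k")
         (simp_all add: sum_smult_unit del: sum.lessThan_Suc, simp add: add.commute)
  qed
  also have "fdet (Suc k) A = (\<Prod>i<Suc k. A i i)"
    by (rule fdet_lower_triangular) (auto simp: A_def)
  also have "\<dots> = \<gamma>" by (simp add: A_def)
  finally show ?thesis .
qed

lemma Delta_rotate:
  "Delta k f = (-1) ^ k * Delta k (\<lambda>r. if r < k then f (Suc r) else f 0)"
proof -
  have "Delta k f = (-1) ^ k * fdet (Suc k) (\<lambda>i. coeff (f (if i < k then i + 1 else i - k) mod G k))"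
    unfolding Delta_def using fdet_rotate_rows[of 1 k "\<lambda>r c. coeff (f r mod G k) c"] by simp
  also have "fdet (Suc k) (\<lambda>i. coeff (f (if i < k then i + 1 else i - k) mod G k))
      = Delta k (\<lambda>r. if r < k then f (Suc r) else f 0)"
    unfolding Delta_def by (rule fdet_cong) auto
  finally show ?thesis .
qed

subsection \<open>The determinants of remainders\<close>

lemma Delta_block_0: "Delta k (\<lambda>r. S (Suc k * 0 + 1 + r)) = 1"
proof -
  have "Delta k (\<lambda>r. S (Suc k * 0 + 1 + r)) = fdet (Suc k) (\<lambda>r c. coeff (S (Suc r)) c)"
    unfolding Delta_def
    by (rule fdet_cong) (simp add: mod_poly_less G_monic degree_S del: S.simps)
  then show ?thesis
    by (simp add: fdet_coeff_monic degree_S coeff_S del: S.simps)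
qed

text \<open>Reflection at \<open>Suc k * Suc b\<close> reverses the first \<open>k\<close> elements
  onto the previous block with factors \<open>- (u ^ j)\<close>, up to multiples of its last
  element; the new last element is a multiple of the old one.\<close>

lemma Delta_block_Suc:
  "Delta k (\<lambda>r. S (Suc k * Suc b + 1 + r)) =
    (- u) ^ (Suc k choose 2) * (s (Suc k * Suc (Suc b)) / s (Suc k * Suc b))
      * Delta k (\<lambda>r. S (Suc k * b + 1 + r))"
proof -
  define B where "B = Suc k * Suc b"
  define c where "c = (\<lambda>j. (s (B + j) + u ^ j * s (B - j)) / s B)"
  define \<gamma> where "\<gamma> = s (Suc k * Suc (Suc b)) / s B"
  define A where "A = (\<lambda>r l. if r < k then (if l = k - 1 - r then - (u ^ Suc r) else 0)
      + (if l = k then c (Suc r) else 0) else (if l = k then \<gamma> else 0))"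
  let ?h = "\<lambda>r. S (Suc k * b + 1 + r)"
  have hk: "?h k = S B" by (simp add: B_def algebra_simps del: S.simps)
  have "Delta k (\<lambda>r. S (B + 1 + r)) = fdet (Suc k) A * Delta k ?h"
  proof (rule Delta_combination)
    fix r assume "r \<le> k"
    show "S (B + 1 + r) mod G k = (\<Sum>l<Suc k. smult (A r l) (?h l)) mod G k"
    proof (cases "r < k")
      case True
      then have "(\<Sum>l<Suc k. smult (A r l) (?h l))
          = smult (- (u ^ Suc r)) (?h (k - 1 - r)) + smult (c (Suc r)) (?h k)"
        unfolding A_def
        by (simp add: smult_add_left sum.distrib sum_smult_unit
            del: sum.lessThan_Suc S.simps mult_Suc power_Suc smult_minus_left)
      moreover have "?h (k - 1 - r) = S (B - Suc r)"
        using True by (simp add: B_def del: S.simps)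
          (rule arg_cong[of _ _ S], simp)
      moreover have "S (B + 1 + r) mod G k
          = (smult (c (Suc r)) (S B) - smult (u ^ Suc r) (S (B - Suc r))) mod G k"
        using S_reflect_mod[of "Suc b" "Suc r" k] True
        unfolding B_def c_def by (simp del: S.simps power_Suc)
      ultimately show ?thesis unfolding hk by (simp del: S.simps power_Suc sum.lessThan_Suc)
    next
      case False
      then have r: "r = k" using \<open>r \<le> k\<close> by simp
      have "(\<Sum>l<Suc k. smult (A r l) (?h l)) = smult \<gamma> (S B)"
        unfolding A_def r hk[symmetric]
        by (simp add: sum_smult_unit del: sum.lessThan_Suc S.simps mult_Suc)
      moreover have "B + 1 + r = Suc k * Suc (Suc b)"
        by (simp add: B_def r)
      ultimately show ?thesis
        using S_multiple_mod[of "Suc b" k "Suc (Suc b)"] by (simp only: \<gamma>_def B_def)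
    qed
  qed
  also have "fdet (Suc k) A = fdet k A * \<gamma>"
  proof -
    have "fdet (k + 1) A = fdet k A * fdet 1 (\<lambda>i j. A (k + i) (k + j))"
      by (rule fdet_block_upper) (simp add: A_def)
    also have "fdet 1 (\<lambda>i j. A (k + i) (k + j)) = \<gamma>"
      by (subst fdet_lower_triangular) (simp_all add: A_def)
    finally show ?thesis by simp
  qed
  also have "fdet k A = fdet k (\<lambda>i j. if i + j + 1 = k then - (u ^ Suc i) else 0)"
    by (rule fdet_cong) (auto simp: A_def)
  also have "\<dots> = (-1) ^ (k choose 2) * (\<Prod>i<k. - (u ^ Suc i))"
    by (rule fdet_antidiagonal)
  also have "\<dots> = (- u) ^ (Suc k choose 2)"
  proof (induction k)
    case (Suc k)
    have [simp]: "Suc (Suc k) choose 2 = Suc k + (Suc k choose 2)" for k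
      by (simp add: numeral_2_eq_2)
    show ?case
      using Suc.IH
      by (simp add: numeral_2_eq_2 power_add algebra_simps power_minus[of u])
  qed (simp add: numeral_2_eq_2)
  finally show ?thesis by (simp add: B_def \<gamma>_def del: S.simps mult_Suc mult_Suc_right)
qed

text \<open>The ratios of \<open>s\<close> telescope.\<close>

lemma Delta_block:
  "Delta k (\<lambda>r. S (Suc k * b + 1 + r)) =
    (- u) ^ (b * (Suc k choose 2)) * (s (Suc k * Suc b) / s (Suc k))"
proof (induction b)
  case 0
  have "s (Suc k) \<noteq> 0" by (rule s_nz) simp
  then show ?case
    unfolding Delta_block_0 by (simp del: S.simps)
next
  case (Suc b)
  have "s (Suc k * Suc b) \<noteq> 0" by (rule s_nz) simp
  then show ?case
    unfolding Delta_block_Suc Suc.IH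
    by (simp add: power_add del: S.simps mult_Suc_right)
qed

text \<open>Partial sums of \<open>q\<close> telescope, and summation is unitriangular.\<close>

lemma Delta_q: "Delta k (\<lambda>r. q (n + r)) = Delta k (\<lambda>r. S (n + 1 + r) - S n)"
proof -
  define A where "A = (\<lambda>r l::nat. if l \<le> r then 1 else 0 :: 'a)"
  have sum: "(\<Sum>l<m. q (n + l)) = S (n + m) - S n" for m
    by (induction m) (simp_all add: q_def)
  have "Delta k (\<lambda>r. S (n + 1 + r) - S n) = fdet (Suc k) A * Delta k (\<lambda>r. q (n + r))"
  proof (rule Delta_combination)
    fix r assume "r \<le> k"
    have "(\<Sum>l<Suc k. smult (A r l) (q (n + l))) = (\<Sum>l<Suc r. q (n + l))"
      unfolding A_def using \<open>r \<le> k\<close>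
      by (intro sum.mono_neutral_cong_right) auto
    then show "(S (n + 1 + r) - S n) mod G k = (\<Sum>l<Suc k. smult (A r l) (q (n + l))) mod G k"
      using sum[of "Suc r"] by simp
  qed
  moreover have "fdet (Suc k) A = 1"
    by (subst fdet_lower_triangular) (auto simp: A_def)
  ultimately show ?thesis by simp
qed

text \<open>The subtracted \<open>S (Suc k * b)\<close> is proportional to the last element of the
  block, so only the last diagonal entry changes, to \<open>1 - c\<close>.\<close>

lemma Delta_q_0:
  "Delta k (\<lambda>r. q (Suc k * b + r)) = (- u) ^ (b * (Suc k choose 2))
      * ((s (Suc k * Suc b) - s (Suc k * b)) / s (Suc k))"
proof -
  define c where "c = s (Suc k * b) / s (Suc k * Suc b)"
  have c: "S (Suc k * b) mod G k = smult c (S (Suc k * Suc b)) mod G k"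
    unfolding c_def by (rule S_multiple_mod) simp
  have nz: "s (Suc k * Suc b) \<noteq> 0" by (rule s_nz) simp
  have idx: "Suc k * b + 1 + k = Suc k * Suc b" by simp
  have "Delta k (\<lambda>r. S (Suc k * b + 1 + r) - S (Suc k * b)) =
    (1 - c) * Delta k (\<lambda>r. S (Suc k * b + 1 + r))"
  proof (rule Delta_last_column[where a = "\<lambda>_. - c"])
    fix r
    show "(S (Suc k * b + 1 + r) - S (Suc k * b)) mod G k
        = (S (Suc k * b + 1 + r) + smult (- c) (S (Suc k * b + 1 + k))) mod G k"
      unfolding idx by (simp add: poly_mod_diff_left c del: S.simps mult_Suc mult_Suc_right)
  next
    show "(S (Suc k * b + 1 + k) - S (Suc k * b)) mod G k
        = smult (1 - c) (S (Suc k * b + 1 + k)) mod G k"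
      unfolding idx smult_diff_left by (simp add: poly_mod_diff_left c del: S.simps mult_Suc mult_Suc_right)
  qed
  also have "\<dots> = (- u) ^ (b * (Suc k choose 2))
      * ((s (Suc k * Suc b) - s (Suc k * b)) / s (Suc k))"
  proof -
    have "(1 - c) * s (Suc k * Suc b) = s (Suc k * Suc b) - s (Suc k * b)"
      unfolding c_def using nz by (simp add: left_diff_distrib del: S.simps mult_Suc mult_Suc_right)
    then show ?thesis
      unfolding Delta_block by (simp only: mult.left_commute[of "1 - c"] times_divide_eq_right)
  qed
  finally show ?thesis by (simp only: Delta_q)
qed

text \<open>Reflecting \<open>S (B + 1)\<close> writes the last element through the others plus
  \<open>- (1 + x) * (1 + y)\<close> times \<open>S n\<close>. With \<open>S n\<close> in the
  family, the other \<open>- S n\<close> drop out, and a rotation gives the block from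
  \<open>n\<close>.\<close>

lemma Delta_q_1:
  assumes "k \<ge> 1"
  shows "Delta k (\<lambda>r. q (Suc k * b + 1 + r)) = (-1) ^ Suc k * (1 + x) * (1 + y)
    * (- u) ^ (b * (Suc k choose 2)) * (s (Suc k * Suc b) / s (Suc k))"
proof -
  define n where "n = Suc k * b + 1"
  define B where "B = Suc k * Suc b"
  let ?f = "\<lambda>r. S (n + 1 + r) - S n"
  let ?v = "\<lambda>r. if r < k then ?f r else S n"
  have nB: "n + k = B" by (simp add: n_def B_def)
  have refl: "S (B + 1) mod G k = (smult (- (x + y)) (S B) - smult u (S (B - 1))) mod G k"
    unfolding B_def by (rule S_reflect_mod_1) simp
  have idx: "n + 1 + (k - 1) = B" "n + 1 + k = B + 1" using assms nB by simp_all
  have "Delta k ?f = (- ((1 + x) * (1 + y))) * Delta k ?v"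
  proof (rule Delta_last_row[where a = "\<lambda>l. (if l = k - 1 then - (x + y) else 0)
        + (if k \<ge> 2 \<and> l = k - 2 then - u else 0)"])
    \<comment> \<open>For \<open>k = 1\<close>, \<open>B - 1 = n\<close>, so the term is zero; the
      guard excludes the truncated index \<open>k - 2\<close>.\<close>
    have "(\<Sum>l<k. smult (if k \<ge> 2 \<and> l = k - 2 then - u else 0) (?f l)) = smult (- u) (S (B - 1) - S n)"
    proof (cases "k \<ge> 2")
      case True
      then have "n + 1 + (k - 2) = B - 1" using nB by simp
      moreover have "(\<Sum>l<k. smult (if l = k - 2 then - u else 0) (?f l)) = smult (- u) (?f (k - 2))"
        by (rule sum_smult_unit) (use True in simp)
      ultimately show ?thesis using True by simp
    next
      case False
      then have "B - 1 = n" using nB assms by simp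
      then show ?thesis using False by simp
    qed
    moreover have "(\<Sum>l<k. smult (if l = k - 1 then - (x + y) else 0) (?f l)) = smult (- (x + y)) (S B - S n)"
      unfolding idx(1)[symmetric] by (rule sum_smult_unit) (use assms in simp)
    ultimately have "(\<Sum>l<k. smult ((if l = k - 1 then - (x + y) else 0)
        + (if k \<ge> 2 \<and> l = k - 2 then - u else 0)) (?f l))
       = smult (- (x + y)) (S B - S n) + smult (- u) (S (B - 1) - S n)"
      by (simp only: smult_add_left sum.distrib)
    then have "smult (- ((1 + x) * (1 + y))) (S n) + (\<Sum>l<k. smult ((if l = k - 1 then - (x + y) else 0)
        + (if k \<ge> 2 \<and> l = k - 2 then - u else 0)) (?f l))
       = smult (- (x + y)) (S B) - smult u (S (B - 1)) - S n"
      by (simp only: algebra_simps smult_add_left smult_diff_left smult_add_right smult_diff_right smult_minus_left)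
         (simp add: algebra_simps smult_add_left del: S.simps)
    then show "?f k mod G k = (smult (- ((1 + x) * (1 + y))) (?v k)
       + (\<Sum>l<k. smult ((if l = k - 1 then - (x + y) else 0)
        + (if k \<ge> 2 \<and> l = k - 2 then - u else 0)) (?v l))) mod G k"
      unfolding idx using refl by (simp add: poly_mod_diff_left[of _ "S n"] del: S.simps)
  qed simp
  also have "Delta k ?v = Delta k (\<lambda>r. if r < k then S (n + Suc r) else S n)"
    by (subst Delta_last_column[where a = "\<lambda>_. - 1" and \<gamma> = 1
          and h = "\<lambda>r. if r < k then S (n + Suc r) else S n"]) (simp_all del: S.simps)
  also have "\<dots> = (-1) ^ k * Delta k (\<lambda>r. S (n + r))"
    by (subst Delta_rotate[of k "\<lambda>r. S (n + r)"]) (simp add: power_mult_distrib[symmetric] mult.assoc[symmetric] del: S.simps cong: if_cong)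
  finally have "Delta k ?f = (-1) ^ Suc k * (1 + x) * (1 + y) * Delta k (\<lambda>r. S (n + r))"
    by (simp add: mult_ac)
  then show ?thesis
    unfolding n_def Delta_q Delta_block by (simp only: mult_ac)
qed

text \<open>After rotation \<open>S B - S n\<close> is last. Solving the reflection at
  \<open>B\<close> for \<open>S n = S (B - 1)\<close> brings in \<open>1 / u\<close>; the rest of
  \<open>S B\<close> is proportional to the last element of the next block.\<close>

lemma Delta_q_k:
  assumes "k \<ge> 1"
  shows "Delta k (\<lambda>r. q (Suc k * b + k + r)) = (-1) ^ k * ((1 + x) * (1 + y) / u)
    * (- u) ^ (Suc b * (Suc k choose 2)) * (s (Suc k * Suc b) / s (Suc k))"
proof -
  define n where "n = Suc k * b + k"
  define B where "B = Suc k * Suc b"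
  have nB: "B = Suc n" by (simp add: n_def B_def)
  define c where "c = s B / s (Suc k * Suc (Suc b))"
  let ?f = "\<lambda>r. S (n + 1 + r) - S n"
  let ?h = "\<lambda>r. S (B + 1 + r)"
  let ?v = "\<lambda>r. if r < k then ?h r - S B else ?h k"
  let ?w = "\<lambda>r. if r < k then ?h r - S B else S B - S n"
  have hk: "B + 1 + k = Suc k * Suc (Suc b)" by (simp add: B_def)
  have c: "S B mod G k = smult c (?h k) mod G k"
    unfolding c_def hk unfolding B_def by (rule S_multiple_mod) simp
  have refl: "S (B + 1) mod G k = (smult (- (x + y)) (S B) - smult u (S (B - 1))) mod G k"
    unfolding B_def by (rule S_reflect_mod_1) simp
  have "Delta k ?f = (-1) ^ k * Delta k (\<lambda>r. if r < k then ?f (Suc r) else ?f 0)"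
    by (rule Delta_rotate)
  also have "Delta k (\<lambda>r. if r < k then ?f (Suc r) else ?f 0) = 1 * Delta k ?w"
    by (rule Delta_last_column[where a = "\<lambda>_. 1"]) (simp_all add: nB del: S.simps)
  also have "Delta k ?w = (1 + x) * (1 + y) / u * c * Delta k ?v"
  proof (rule Delta_last_row[where a = "\<lambda>l. if l = 0 then 1 / u else 0"])
    have "(\<Sum>l<k. smult (if l = 0 then 1 / u else 0) (?v l)) = smult (1 / u) (?h 0 - S B)"
      using assms by (subst sum_smult_unit) auto
    moreover have "(S B - S n) mod G k = (smult ((1 + x) * (1 + y) / u) (S B) + smult (1 / u) (?h 0 - S B)) mod G k"
    proof -
      have "S n mod G k = smult (1 / u) (smult u (S n)) mod G k"
        using xy_nz by simp
      also have "\<dots> = smult (1 / u) (smult (- (x + y)) (S B) - (smult (- (x + y)) (S B) - smult u (S (B - 1)))) mod G k"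
        using nB by simp
      also have "\<dots> = smult (1 / u) (smult (- (x + y)) (S B) - S (B + 1)) mod G k"
        by (simp only: mod_smult_left poly_mod_diff_left refl)
      finally have n: "S n mod G k = \<dots>" .
      have "(S B - S n) mod G k = (S B - smult (1 / u) (smult (- (x + y)) (S B) - S (B + 1))) mod G k"
        by (simp only: poly_mod_diff_left n)
      also have "S B - smult (1 / u) (smult (- (x + y)) (S B) - S (B + 1))
        = smult ((1 + x) * (1 + y) / u) (S B) + smult (1 / u) (?h 0 - S B)"
        by (rule poly_eqI) (use xy_nz in \<open>simp add: field_simps del: S.simps\<close>)
      finally show ?thesis .
    qed
    ultimately show "?w k mod G k = (smult ((1 + x) * (1 + y) / u * c) (?v k) +
       (\<Sum>l<k. smult (if l = 0 then 1 / u else 0) (?v l))) mod G k"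
      by (simp only: poly_mod_add_left mod_smult_left smult_smult[symmetric] c less_irrefl if_False)
  qed simp
  also have "Delta k ?v = 1 * Delta k ?h"
    by (rule Delta_last_column[where a = "\<lambda>_. - c"]) (simp_all add: poly_mod_diff_left c del: S.simps)
  also have "Delta k ?h = (- u) ^ (Suc b * (Suc k choose 2)) * (s (Suc k * Suc (Suc b)) / s (Suc k))"
    unfolding B_def by (rule Delta_block)
  finally have "Delta k ?f = (-1) ^ k * ((1 + x) * (1 + y) / u)
    * (- u) ^ (Suc b * (Suc k choose 2)) * (c * s (Suc k * Suc (Suc b)) / s (Suc k))"
    by (simp add: mult_ac del: S.simps mult_Suc mult_Suc_right)
  moreover have "c * s (Suc k * Suc (Suc b)) = s (Suc k * Suc b)"
    using s_nz[of "Suc k * Suc (Suc b)"] unfolding c_def B_def by simp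
  ultimately show ?thesis
    unfolding n_def Delta_q by simp
qed

text \<open>Indices beyond the block reflect to at least \<open>Suc k * b + 2\<close>, so its first
  element never occurs.\<close>

lemma S_span_mod:
  assumes "2 \<le> i" and "i \<le> 2 * k"
  shows "\<exists>a. a 0 = 0 \<and> S (Suc k * b + i) mod G k = (\<Sum>l<Suc k. smult (a l) (S (Suc k * b + 1 + l))) mod G k"
proof (cases "i \<le> Suc k")
  case True
  then have "(\<Sum>l<Suc k. smult (if l = i - 1 then 1 else 0) (S (Suc k * b + 1 + l))) = S (Suc k * b + i)"
    using assms by (subst sum_smult_unit) (auto simp del: S.simps)
  then show ?thesis
    using assms by (intro exI[of _ "\<lambda>l. if l = i - 1 then 1 else 0"]) (simp del: S.simps sum.lessThan_Suc)
next
  case False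
  define j where "j = i - Suc k"
  define B where "B = Suc k * Suc b"
  have j: "0 < j" "j < k" "Suc k * b + i = B + j"
    using False assms by (auto simp: j_def B_def)
  define c where "c = (s (B + j) + u ^ j * s (B - j)) / s B"
  define a where "a = (\<lambda>l. (if l = k then c else 0) + (if l = k - j then - (u ^ j) else 0))"
  have idx: "Suc k * b + 1 + k = B" "Suc k * b + 1 + (k - j) = B - j" using j by (auto simp: B_def)
  have "(\<Sum>l<Suc k. smult (a l) (S (Suc k * b + 1 + l)))
      = smult c (S (Suc k * b + 1 + k)) + smult (- (u ^ j)) (S (Suc k * b + 1 + (k - j)))"
    unfolding a_def smult_add_left sum.distrib using j
    by (intro arg_cong2[of _ _ _ _ "(+)"] sum_smult_unit) auto
  also have "\<dots> = smult c (S B) - smult (u ^ j) (S (B - j))"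
    unfolding idx by simp
  also have "\<dots> mod G k = S (B + j) mod G k"
    unfolding c_def B_def by (rule S_reflect_mod[symmetric]) (use j in auto)
  finally have "S (Suc k * b + i) mod G k = (\<Sum>l<Suc k. smult (a l) (S (Suc k * b + 1 + l))) mod G k"
    using j(3) by simp
  moreover have "a 0 = 0" using j by (auto simp: a_def)
  ultimately show ?thesis by blast
qed

text \<open>All \<open>Suc k\<close> differences lie in the span of the \<open>k\<close> elements of
  the block other than the first.\<close>

lemma Delta_q_other:
  assumes "2 \<le> i" and "i < k"
  shows "Delta k (\<lambda>r. q (Suc k * b + i + r)) = 0"
proof -
  let ?h = "\<lambda>l. S (Suc k * b + 1 + l)"
  have "\<exists>A. \<forall>r\<le>k. A r 0 = 0 \<and> (S (Suc k * b + i + 1 + r) - S (Suc k * b + i)) mod G k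
      = (\<Sum>l<Suc k. smult (A r l) (?h l)) mod G k"
  proof (rule choice, rule allI)
    fix r
    show "\<exists>a. r \<le> k \<longrightarrow> a 0 = 0 \<and> (S (Suc k * b + i + 1 + r) - S (Suc k * b + i)) mod G k
      = (\<Sum>l<Suc k. smult (a l) (?h l)) mod G k"
    proof (cases "r \<le> k")
      case True
      obtain a where a: "a 0 = 0" "S (Suc k * b + (i + 1 + r)) mod G k = (\<Sum>l<Suc k. smult (a l) (?h l)) mod G k"
        using S_span_mod[of "i + 1 + r" k b] True assms by auto
      obtain a' where a': "a' 0 = 0" "S (Suc k * b + i) mod G k = (\<Sum>l<Suc k. smult (a' l) (?h l)) mod G k"
        using S_span_mod[of i k b] assms by auto
      have "(S (Suc k * b + (i + 1 + r)) - S (Suc k * b + i)) mod G k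
        = (\<Sum>l<Suc k. smult (a l - a' l) (?h l)) mod G k"
        by (simp only: smult_diff_left sum_subtractf poly_mod_diff_left a a')
      then show ?thesis
        using a a' by (intro exI[of _ "\<lambda>l. a l - a' l"]) (simp only: add.assoc diff_self simp_thms)
    qed simp
  qed
  then obtain A where A: "\<And>r. r \<le> k \<Longrightarrow> A r 0 = 0"
    "\<And>r. r \<le> k \<Longrightarrow> (S (Suc k * b + i + 1 + r) - S (Suc k * b + i)) mod G k
      = (\<Sum>l<Suc k. smult (A r l) (?h l)) mod G k"
    by blast
  have "Delta k (\<lambda>r. S (Suc k * b + i + 1 + r) - S (Suc k * b + i)) = fdet (Suc k) A * Delta k ?h"
    by (rule Delta_combination) (rule A)
  also have "fdet (Suc k) A = 0"
    by (rule fdet_zero_column[of 0]) (use A(1) in auto)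
  finally show ?thesis by (simp add: Delta_q)
qed

subsection \<open>The Hankel determinants over a field\<close>

lemma hankel_det_eq:
  "fdet n (\<lambda>i j. mom k (i + j + 1)) = (-1) ^ (n * Suc k) * u ^ (n choose 2) * Delta k (\<lambda>r. q (n + r))"
proof -
  have "monom 1 (i + j) * G k = monom 1 (i + j + 1) * S (Suc k)" for i j
    unfolding G_def by (simp add: mult.assoc[symmetric] mult_monom del: S.simps)
  then have "fdet n (\<lambda>i j. mom k (i + j + 1)) = fdet n (\<lambda>i j. M (monom 1 (i + j) * G k))"
    by (simp only: M_monom_S)
  also have "\<dots> = (-1) ^ (n * Suc k) * (\<Prod>i<n. u ^ i) * fdet (Suc k) (\<lambda>r c. coeff (q (n + r) mod G k) c)"
    by (rule christoffel_determinant)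
       (use xy_nz in \<open>simp_all add: linear_form_axioms degree_q coeff_q M_q_q G_monic\<close>)
  also have "(\<Prod>i<n. u ^ i) = u ^ (n choose 2)"
    by (induction n) (simp_all add: numeral_2_eq_2 power_add algebra_simps)
  finally show ?thesis by (simp add: Delta_def)
qed

definition Q :: "nat \<Rightarrow> nat \<Rightarrow> 'a" where
  "Q k m = (y ^ (Suc k * m) - x ^ (Suc k * m)) / (y ^ Suc k - x ^ Suc k)"

lemma s_ratio: "s (Suc k * m) / s (Suc k) = (-1) ^ (Suc k * m + Suc k) * Q k m"
proof -
  have neq: "y - x \<noteq> 0" using pow_neq[of 1] by simp
  have nz: "y ^ Suc k - x ^ Suc k \<noteq> 0" using pow_neq[of "Suc k"] by (simp del: power_Suc)
  have sm: "s m = (-1) ^ m * ((x ^ m - y ^ m) / (y - x))" for m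
    using s_closed[of m] neq
    by (simp add: field_simps power_minus[of x m] power_minus[of y m])
  have "((-1) ^ Suc k :: 'a) * (-1) ^ Suc k = 1"
    by (simp add: power_mult_distrib[symmetric] del: power_Suc)
  then show ?thesis
    unfolding sm Q_def power_add using neq nz
    by (simp add: divide_simps del: power_Suc mult_Suc) (simp add: algebra_simps del: power_Suc mult_Suc)
qed

lemma hankel_det_0:
  "fdet (Suc k * b) (\<lambda>i j. mom k (i + j + 1)) = (-1) ^ (b * (Suc k choose 2))
     * u ^ ((Suc k)\<^sup>2 * ((b + 1) choose 2) - Suc k * b) * (Q k (b + 1) + (-1) ^ k * Q k b)"
proof -
  let ?c = "Suc k choose 2"
  have "(s (Suc k * Suc b) - s (Suc k * b)) / s (Suc k)
      = (-1) ^ (Suc k * Suc b + Suc k) * Q k (Suc b) - (-1) ^ (Suc k * b + Suc k) * Q k b"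
    by (simp only: diff_divide_distrib s_ratio)
  \<comment> \<open>Only parities matter: \<open>Suc k * b * Suc k\<close> has that of
    \<open>Suc k * b\<close>, and \<open>- (-1) ^ Suc k\<close> is \<open>(-1) ^ k\<close>.\<close>
  also have "\<dots> = (-1) ^ (Suc k * b * Suc k) * (Q k (b + 1) + (-1) ^ k * Q k b)"
    by (simp add: minus_one_power_iff algebra_simps)
  finally have "fdet (Suc k * b) (\<lambda>i j. mom k (i + j + 1)) = (-1) ^ (Suc k * b * Suc k) * (-1) ^ (Suc k * b * Suc k) *
      (u ^ (Suc k * b choose 2) * (- u) ^ (b * ?c) * (Q k (b + 1) + (-1) ^ k * Q k b))"
    unfolding hankel_det_eq Delta_q_0 by (simp only: mult_ac)
  also have "(-1 :: 'a) ^ (Suc k * b * Suc k) * (-1) ^ (Suc k * b * Suc k) = 1"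
    by (simp add: power_mult_distrib[symmetric] del: mult_Suc mult_Suc_right)
  also have "u ^ (Suc k * b choose 2) * (- u) ^ (b * ?c) = (-1) ^ (b * ?c) * u ^ ((Suc k * b choose 2) + b * ?c)"
    by (subst power_minus) (simp only: power_add mult_ac)
  also have "(Suc k * b choose 2) + b * ?c = (Suc k)\<^sup>2 * ((b + 1) choose 2) - Suc k * b"
    using choose_two_mult[of "Suc k" b] by linarith
  finally show ?thesis by (simp only: mult_1_left)
qed

lemma hankel_det_1:
  assumes "k \<ge> 1"
  shows "fdet (Suc k * b + 1) (\<lambda>i j. mom k (i + j + 1)) = (-1) ^ (b * (Suc k choose 2))
     * u ^ ((Suc k)\<^sup>2 * ((b + 1) choose 2)) * (1 + x) * (1 + y) * Q k (b + 1)"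
proof -
  let ?c = "Suc k choose 2" and ?n = "Suc k * b + 1"
  have "fdet ?n (\<lambda>i j. mom k (i + j + 1))
     = ((-1) ^ (?n * Suc k) * (-1) ^ Suc k * (-1) ^ (Suc k * Suc b + Suc k))
       * ((u ^ (?n choose 2) * (- u) ^ (b * ?c)) * (1 + x) * (1 + y) * Q k (Suc b))"
    unfolding hankel_det_eq Delta_q_1[OF assms] s_ratio by (simp only: mult_ac)
  also have "(-1 :: 'a) ^ (?n * Suc k) * (-1) ^ Suc k * (-1) ^ (Suc k * Suc b + Suc k) = 1"
    by (simp only: power_add[symmetric] minus_one_power_iff) simp
  also have "u ^ (?n choose 2) * (- u) ^ (b * ?c) = (-1) ^ (b * ?c) * u ^ ((?n choose 2) + b * ?c)"
    by (subst power_minus) (simp only: power_add mult_ac)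
  also have "?n choose 2 = (Suc k * b choose 2) + Suc k * b"
    by (subst choose_two_add) (simp add: numeral_2_eq_2)
  also have "(Suc k * b choose 2) + Suc k * b + b * ?c = (Suc k)\<^sup>2 * ((b + 1) choose 2)"
    using choose_two_mult[of "Suc k" b] by linarith
  finally show ?thesis by (simp only: mult_1_left Suc_eq_plus1)
qed

lemma hankel_det_k:
  assumes "k \<ge> 1"
  shows "fdet (Suc k * b + k) (\<lambda>i j. mom k (i + j + 1)) = (-1) ^ ((b + 1) * (Suc k choose 2) + k)
     * u ^ ((Suc k)\<^sup>2 * ((b + 1) choose 2) + (k\<^sup>2 - 1) * (b + 1)) * (1 + x) * (1 + y) * Q k (b + 1)"
proof -
  let ?c = "Suc k choose 2" and ?n = "Suc k * b + k"
  let ?e = "(Suc k)\<^sup>2 * ((b + 1) choose 2) + (k\<^sup>2 - 1) * (b + 1)"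
  have "fdet ?n (\<lambda>i j. mom k (i + j + 1))
     = ((-1) ^ (?n * Suc k) * (-1) ^ k * (-1) ^ (Suc k * Suc b + Suc k))
       * ((u ^ (?n choose 2) * (- u) ^ (Suc b * ?c)) * ((1 + x) * (1 + y) / u) * Q k (Suc b))"
    unfolding hankel_det_eq Delta_q_k[OF assms] s_ratio by (simp only: mult_ac)
  also have "(-1 :: 'a) ^ (?n * Suc k) * (-1) ^ k * (-1) ^ (Suc k * Suc b + Suc k) = (-1) ^ k"
    by (simp only: power_add[symmetric] minus_one_power_iff) simp
  also have "u ^ (?n choose 2) * (- u) ^ (Suc b * ?c) = (-1) ^ (Suc b * ?c) * u ^ ((?n choose 2) + Suc b * ?c)"
    by (subst power_minus) (simp only: power_add mult_ac)
  \<comment> \<open>The extra power of \<open>u\<close> cancels the denominator from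
    \<open>Delta_q_k\<close>. Writing \<open>k = Suc l\<close> makes \<open>k\<^sup>2 - 1\<close> a
    true difference.\<close>
  also have "(?n choose 2) + Suc b * ?c = Suc ?e"
  proof -
    have "?n choose 2 = (Suc k * b choose 2) + (k choose 2) + Suc k * b * k"
      by (rule choose_two_add)
    moreover have "?c = (k choose 2) + k" by (simp add: numeral_2_eq_2)
    moreover obtain l where "k = Suc l" using assms by (cases k) auto
    ultimately show ?thesis
      using choose_two_mult[of "Suc k" b] choose_two_double[of k]
      by (simp add: power2_eq_square algebra_simps)
  qed
  also have "(-1) ^ k * ((-1) ^ (Suc b * ?c) * u ^ Suc ?e * ((1 + x) * (1 + y) / u) * Q k (Suc b))
      = (-1) ^ (Suc b * ?c + k) * (u ^ Suc ?e * ((1 + x) * (1 + y) / u)) * Q k (Suc b)"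
    by (simp only: power_add mult_ac)
  also have "u ^ Suc ?e * ((1 + x) * (1 + y) / u) = u ^ ?e * (1 + x) * (1 + y)"
    using xy_nz by simp
  finally show ?thesis by (simp only: Suc_eq_plus1 mult.assoc)
qed

lemma hankel_det_other:
  assumes "2 \<le> i" and "i < k"
  shows "fdet (Suc k * b + i) (\<lambda>i j. mom k (i + j + 1)) = 0"
  unfolding hankel_det_eq Delta_q_other[OF assms] by simp

end

subsection \<open>Three-step paths\<close>

lemma finite_nonneg_paths: "finite (nonneg_paths n k l)"
  by (rule finite_subset[OF _ finite_lists_length_eq[of "{-1, 0, 1 :: int}" n]])
     (auto simp: nonneg_paths_def)

lemma Cons_mem_nonneg_paths:
  "t # p \<in> nonneg_paths (Suc n) k l \<longleftrightarrow>
     t \<in> {-1, 0, 1} \<and> 0 \<le> int k + t \<and> p \<in> nonneg_paths n (nat (int k + t)) l"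
proof -
  have "(\<forall>i\<le>Suc n. int k + sum_list (take i (t # p)) \<ge> 0)
      \<longleftrightarrow> (\<forall>i\<le>n. int k + t + sum_list (take i p) \<ge> 0)"
    by (auto simp: take_Cons' add.assoc)
  \<comment> \<open>The empty prefix gives the height after the first step, so \<open>nat\<close>
    loses nothing.\<close>
  moreover have "(\<forall>i\<le>n. int k + t + sum_list (take i p) \<ge> 0) \<Longrightarrow> 0 \<le> int k + t"
    by (drule spec[of _ 0]) simp
  ultimately show ?thesis
    by (auto simp: nonneg_paths_def algebra_simps)
qed

lemma nonneg_paths_Suc:
  "nonneg_paths (Suc n) k l = (#) 1 ` nonneg_paths n (Suc k) l \<union>
     ((#) 0 ` nonneg_paths n k l \<union> (if k = 0 then {} else (#) (-1) ` nonneg_paths n (k - 1) l))"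
proof (rule Set.set_eqI)
  fix p
  show "p \<in> nonneg_paths (Suc n) k l \<longleftrightarrow> p \<in> (#) 1 ` nonneg_paths n (Suc k) l \<union>
     ((#) 0 ` nonneg_paths n k l \<union> (if k = 0 then {} else (#) (-1) ` nonneg_paths n (k - 1) l))"
  proof (cases p)
    case Nil
    then show ?thesis by (auto simp: nonneg_paths_def)
  next
    case (Cons t p')
    have "nat (int k + 1) = Suc k" "nat (int k - 1) = k - 1" by simp_all
    then show ?thesis
      unfolding Cons Cons_mem_nonneg_paths by (auto simp: image_iff)
  qed
qed

section \<open>First-step recursion for the path sums\<close>

lemma Pplus_0: "Pplus 0 k l = (if l = k then 1 else 0)"
proof -
  have "nonneg_paths 0 k l = (if l = k then {[]} else {})"
    by (auto simp: nonneg_paths_def)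
  then show ?thesis by (simp add: Pplus_def path_weight_def)
qed

lemma Pplus_Suc:
  "Pplus (Suc n) k l = Pplus n (Suc k) l + (varX + varY) * Pplus n k l
     + (if k = 0 then 0 else varX * varY * Pplus n (k - 1) l)"
proof -
  have cons: "sum path_weight ((#) t ` nonneg_paths n k' l) = step_weight t * Pplus n k' l" for t k'
    unfolding Pplus_def
    by (subst sum.reindex) (auto simp: path_weight_def sum_distrib_left)
  have "sum path_weight (nonneg_paths (Suc n) k l) = sum path_weight ((#) 1 ` nonneg_paths n (Suc k) l)
     + (sum path_weight ((#) 0 ` nonneg_paths n k l)
       + sum path_weight (if k = 0 then {} else (#) (-1) ` nonneg_paths n (k - 1) l))"
    unfolding nonneg_paths_Suc
    by (subst sum.union_disjoint; (subst sum.union_disjoint)?) (auto simp: finite_nonneg_paths)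
  then show ?thesis
    by (simp add: Pplus_def[of "Suc n"] cons step_weight_def)
qed

lemma Pplus_eq_0: "k + n < l \<Longrightarrow> Pplus n k l = 0"
  by (induction n arbitrary: k) (auto simp: Pplus_0 Pplus_Suc)

text \<open>A common bound \<open>N\<close> gives all sums one finite range, so that
  \<open>Pplus_Suc\<close> can be summed termwise.\<close>

lemma Sum_any_Pplus_eq:
  assumes "k + n \<le> N"
  shows "Sum_any (Pplus n k) = (\<Sum>l\<le>N. Pplus n k l)"
proof (rule Sum_any.expand_superset)
  show "{l. Pplus n k l \<noteq> 0} \<subseteq> {..N}"
    using Pplus_eq_0[of k n] assms by (force simp: not_less[symmetric])
qed simp

lemma Sum_any_Pplus_0: "Sum_any (Pplus 0 k) = 1"
  by (subst Sum_any_Pplus_eq[of _ _ k]) (simp_all add: Pplus_0)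

lemma Sum_any_Pplus_Suc:
  "Sum_any (Pplus (Suc n) k) = Sum_any (Pplus n (Suc k)) + (varX + varY) * Sum_any (Pplus n k)
     + (if k = 0 then 0 else varX * varY * Sum_any (Pplus n (k - 1)))"
  by (subst (1 2 3 4) Sum_any_Pplus_eq[of _ _ "k + Suc n"])
     (simp_all add: Pplus_Suc sum.distrib sum_distrib_left del: sum.atMost_Suc)

section \<open>Transfer to the fraction field\<close>

lemma varY_power: "varY ^ m = monom 1 m"
  by (simp add: varY_def monom_altdef)

lemma varX_power: "varX ^ m = [:[:0, 1:] ^ m:]"
  by (simp add: varX_def poly_const_pow)

lemma varX_power_neq_varY_power:
  assumes "m > 0"
  shows "varX ^ m \<noteq> varY ^ m"
proof
  assume "varX ^ m = varY ^ m"
  then have "coeff (varX ^ m) m = coeff (varY ^ m) m" by simp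
  then show False
    using assms by (simp add: varX_power varY_power coeff_pCons split: nat.splits)
qed

interpretation to_fract: inj_comm_ring_hom "to_fract :: int poly poly \<Rightarrow> int poly poly fract"
  by unfold_locales auto

interpretation xy: chebyshev_data "to_fract varX" "to_fract varY"
proof
  have "varX * varY \<noteq> 0" by (auto simp: varX_def varY_def)
  then show "to_fract varX * to_fract varY \<noteq> 0" by (metis to_fract_eq_0_iff to_fract_mult)
next
  fix m :: nat
  assume "m > 0"
  then show "to_fract varX ^ m \<noteq> to_fract varY ^ m"
    using varX_power_neq_varY_power by (simp add: to_fract.hom_power[symmetric])
qed

lemma to_fract_moment: "to_fract (Sum_any (Pplus n k)) = xy.mom k n"
proof (induction n arbitrary: k)
  case 0
  then show ?case by (simp add: Sum_any_Pplus_0)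
next
  case (Suc n)
  then show ?case by (cases k) (simp_all add: Sum_any_Pplus_Suc)
qed

text \<open>\<open>a - b\<close> divides \<open>a ^ m - b ^ m\<close>, so the \<open>div\<close> in
  \<open>Qpoly\<close> is exact and agrees with division in the field.\<close>

lemma to_fract_Qpoly: "to_fract (Qpoly k m) = xy.Q k m"
proof -
  have "varY ^ (k + 1) - varX ^ (k + 1) dvd varY ^ ((k + 1) * m) - varX ^ ((k + 1) * m)"
    unfolding power_mult by (subst power_diff_sumr2) simp
  then obtain R where R: "varY ^ ((k + 1) * m) - varX ^ ((k + 1) * m) = (varY ^ (k + 1) - varX ^ (k + 1)) * R"
    by (rule dvdE)
  have nz: "varY ^ (k + 1) - varX ^ (k + 1) \<noteq> 0"
    using varX_power_neq_varY_power[of "k + 1"] by simp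
  then have "Qpoly k m = R"
    unfolding Qpoly_def R by (rule nonzero_mult_div_cancel_left)
  moreover have "to_fract (varY ^ ((k + 1) * m) - varX ^ ((k + 1) * m))
      = to_fract (varY ^ (k + 1) - varX ^ (k + 1)) * to_fract R"
    unfolding R by simp
  moreover have "to_fract (varY ^ (k + 1) - varX ^ (k + 1)) \<noteq> 0"
    using nz by (simp only: to_fract_eq_0_iff not_False_eq_True)
  ultimately show ?thesis
    unfolding xy.Q_def by (simp add: to_fract.hom_power field_simps del: power_Suc mult_Suc)
qed

lemma to_fract_hankel_det:
  "to_fract (det (mat n n (\<lambda>(i, j). Sum_any (\<lambda>l. Pplus (i + j + 1) k l))))
    = fdet n (\<lambda>i j. xy.mom k (i + j + 1))"
proof -
  have "fdet n (\<lambda>i j. xy.mom k (i + j + 1))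
      = det (map_mat to_fract (mat n n (\<lambda>(i, j). Sum_any (\<lambda>l. Pplus (i + j + 1) k l))))"
    unfolding fdet_def to_fract_moment[symmetric]
    by (rule arg_cong[of _ _ det]) (auto intro!: eq_matI)
  then show ?thesis by simp
qed

theorem theorem4:
  fixes n k n1 :: nat
  assumes "n \<ge> 1"
  defines "D \<equiv> det (mat n n (\<lambda>(i, j). Sum_any (\<lambda>l. Pplus (i + j + 1) k l)))"
  shows
   "(n = (k+1)*n1 \<longrightarrow>
       D = (-1) ^ (n1 * ((k+1) choose 2)) * (varX * varY) ^ ((k+1)^2 * ((n1+1) choose 2) - n)
           * (Qpoly k (n1+1) + (-1)^k * Qpoly k n1))
  \<and> (k \<ge> 1 \<and> n = (k+1)*n1 + 1 \<longrightarrow>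
       D = (-1) ^ (n1 * ((k+1) choose 2)) * (varX * varY) ^ ((k+1)^2 * ((n1+1) choose 2))
           * (1 + varX) * (1 + varY) * Qpoly k (n1+1))
  \<and> (k \<ge> 2 \<and> n = (k+1)*n1 + k \<longrightarrow>
       D = (-1) ^ ((n1+1) * ((k+1) choose 2) + k)
           * (varX * varY) ^ ((k+1)^2 * ((n1+1) choose 2) + (k^2 - 1) * (n1+1))
           * (1 + varX) * (1 + varY) * Qpoly k (n1+1))
  \<and> (n mod (k+1) \<notin> {0, 1, k} \<longrightarrow> D = 0)"
proof -
  have D: "to_fract D = fdet n (\<lambda>i j. xy.mom k (i + j + 1))"
    unfolding D_def by (rule to_fract_hankel_det)
  \<comment> \<open>\<open>to_fract\<close> is injective, so it suffices to compare images in the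
    fraction field.\<close>
  note homs = to_fract_mult to_fract_add to_fract_uminus to_fract_1 to_fract.hom_power to_fract_Qpoly
  show ?thesis
  proof (intro conjI impI)
    assume n: "n = (k+1)*n1"
    show "D = (-1) ^ (n1 * ((k+1) choose 2)) * (varX * varY) ^ ((k+1)^2 * ((n1+1) choose 2) - n)
           * (Qpoly k (n1+1) + (-1)^k * Qpoly k n1)"
      by (rule to_fract_eq_iff[THEN iffD1], unfold D homs,
          unfold n Suc_eq_plus1[symmetric, of k], rule xy.hankel_det_0)
  next
    assume n: "k \<ge> 1 \<and> n = (k+1)*n1 + 1"
    then have k: "k \<ge> 1" and n: "n = (k+1)*n1 + 1" by auto
    show "D = (-1) ^ (n1 * ((k+1) choose 2)) * (varX * varY) ^ ((k+1)^2 * ((n1+1) choose 2))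
           * (1 + varX) * (1 + varY) * Qpoly k (n1+1)"
      by (rule to_fract_eq_iff[THEN iffD1], unfold D homs,
          unfold n Suc_eq_plus1[symmetric, of k], rule xy.hankel_det_1[OF k])
  next
    assume "k \<ge> 2 \<and> n = (k+1)*n1 + k"
    then have k: "k \<ge> 1" and n: "n = (k+1)*n1 + k" by auto
    show "D = (-1) ^ ((n1+1) * ((k+1) choose 2) + k)
           * (varX * varY) ^ ((k+1)^2 * ((n1+1) choose 2) + (k^2 - 1) * (n1+1))
           * (1 + varX) * (1 + varY) * Qpoly k (n1+1)"
      by (rule to_fract_eq_iff[THEN iffD1], unfold D homs,
          unfold n Suc_eq_plus1[symmetric, of k], rule xy.hankel_det_k[OF k])
  next
    assume r: "n mod (k+1) \<notin> {0, 1, k}"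
    then have "n mod (k+1) \<noteq> 0" "n mod (k+1) \<noteq> 1" "n mod (k+1) \<noteq> k" by simp_all
    moreover have "n mod (k+1) < k + 1" by (rule mod_less_divisor) simp
    \<comment> \<open>The remaining residues lie strictly between \<open>1\<close> and
      \<open>k\<close>.\<close>
    ultimately have "2 \<le> n mod (k+1)" "n mod (k+1) < k" by linarith+
    then have "fdet (Suc k * (n div (k+1)) + n mod (k+1)) (\<lambda>i j. xy.mom k (i + j + 1)) = 0"
      by (rule xy.hankel_det_other)
    moreover have "Suc k * (n div (k+1)) + n mod (k+1) = n"
      using mult_div_mod_eq[of "k + 1" n] by simp
    ultimately have "to_fract D = 0" by (simp only: D)
    then show "D = 0" by simp
  qed
qed

end
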